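(* Let $f$ be a Möbius transformation with $f(\mathbb{B}^n)=\mathbb{B}^n$. Then for all $x,y\in\mathbb{B}^n$, we have $$\frac13\,u_{\mathbb{B}^n}(x,y)\le u_{\mathbb{B}^n}(f(x),f(y))\le 3\,u_{\mathbb{B}^n}(x,y),$$ and both inequalities are sharp.
   Context: $\overline{\mathbb{R}}^n=\mathbb{R}^n\cup\{\infty\}$; a Möbius transformation of $\overline{\mathbb{R}}^n$ is a finite composition of reflections (inversions) in spheres and hyperplanes. $\mathbb{B}^n=\{z\in\mathbb{R}^n:|z|<1\}$, where $|\cdot|$ is the Euclidean norm. For a domain $D\subsetneq\mathbb{R}^n$ and $x\in D$, $d(x)$ denotes the Euclidean distance from $x$ to the boundary of $D$, and the Gromov hyperbolic metric $u_D$ is $$u_D(x,y)=2\log\frac{|x-y|+\max\{d(x),d(y)\}}{\sqrt{d(x)\,d(y)}},\qquad x,y\in D.$$ For $D=\mathbb{B}^n$ one has $d(x)=1-|x|$. "Sharp" means that the constants $\frac13$ and $3$ are the best possible for inequalities holding for all such $f$ and all $x,y\in\mathbb{B}^n$. *)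

theory Defs
  imports "HOL-Analysis.Analysis"
begin

text \<open>The extended space is \<open>'a option\<close>: \<open>Some x\<close> is the finite point \<open>x\<close> and \<open>None\<close> is the
  point at infinity, as in the library's Alexandroff compactification.\<close>

definition sphere_reflection ::
    "'a::euclidean_space \<Rightarrow> real \<Rightarrow> 'a option \<Rightarrow> 'a option" where
  "sphere_reflection a r z =
    (case z of
      None \<Rightarrow> Some a
    | Some x \<Rightarrow> if x = a then None else Some (a + (r\<^sup>2 / (norm (x - a))\<^sup>2) *\<^sub>R (x - a)))"

text \<open>Reflection in the hyperplane \<open>{x. a \<bullet> x = b}\<close>, for \<open>a \<noteq> 0\<close>.\<close>

definition hyperplane_reflection ::
    "'a::euclidean_space \<Rightarrow> real \<Rightarrow> 'a option \<Rightarrow> 'a option" where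
  "hyperplane_reflection a b = map_option (\<lambda>x. x - (2 * (a \<bullet> x - b) / (a \<bullet> a)) *\<^sub>R a)"

inductive moebius :: "('a::euclidean_space option \<Rightarrow> 'a option) \<Rightarrow> bool" where
  moebius_id: "moebius id"
| moebius_sphere: "moebius f \<Longrightarrow> r > 0 \<Longrightarrow> moebius (sphere_reflection a r \<circ> f)"
| moebius_hyperplane: "moebius f \<Longrightarrow> a \<noteq> 0 \<Longrightarrow> moebius (hyperplane_reflection a b \<circ> f)"

definition moebius_self_maps ::
    "'a::euclidean_space set \<Rightarrow> ('a option \<Rightarrow> 'a option) set" where
  "moebius_self_maps D = {f. moebius f \<and> f ` (Some ` D) = Some ` D}"

text \<open>Only meaningful for a domain \<open>D \<noteq> UNIV\<close> and points of \<open>D\<close>: \<open>infdist x {} = 0\<close>.\<close>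

definition gromov_dist :: "'a::euclidean_space set \<Rightarrow> 'a \<Rightarrow> 'a \<Rightarrow> real" where
  "gromov_dist D x y =
    (let d = (\<lambda>z. infdist z (frontier D))
     in 2 * ln ((norm (x - y) + max (d x) (d y)) / sqrt (d x * d y)))"

text \<open>For \<open>f \<in> moebius_self_maps D\<close> and \<open>x \<in> D\<close> the image \<open>f (Some x)\<close> is finite, so \<open>the\<close> recovers
  the point \<open>f(x) \<in> D\<close>.\<close>

abbreviation fin_app :: "('a option \<Rightarrow> 'a option) \<Rightarrow> 'a \<Rightarrow> 'a" where
  "fin_app f x \<equiv> the (f (Some x))"

end

theory Submission
  imports Defs "HOL-Real_Asymp.Real_Asymp"
begin

text \<open>
  The proof compares the Gromov hyperbolic metric \<open>u\<close> of the unit ball with the hyperbolic metric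
  \<open>\<rho>(x, y) = 2 arsinh (|x - y| / sqrt ((1 - |x|\<^sup>2) (1 - |y|\<^sup>2)))\<close>, which is invariant under every
  Moebius self-map of the ball. The comparison \<open>\<rho> \<le> u \<le> 3\<rho>\<close> (lemma \<open>gromov_dist_hyp_dist\<close>) then
  gives both inequalities at once: \<open>u(f x, f y) \<le> 3 \<rho>(f x, f y) = 3 \<rho>(x, y) \<le> 3 u(x, y)\<close>, and
  \<open>u(f x, f y) \<ge> \<rho>(f x, f y) = \<rho>(x, y) \<ge> u(x, y) / 3\<close>.

  Invariance of \<open>\<rho>\<close> (lemma \<open>hyp_dist_moebius\<close>) cannot be read off from the generating reflections,
  since the intermediate maps need not preserve the ball. It rests on a property that does
  survive composition: \<open>|f z - f w| = \<mu>(z) \<mu>(w) |z - w|\<close> for a positive function \<open>\<mu>\<close>, with the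
  distance suitably interpreted at infinity (lemma \<open>moebius_ext_dist\<close>). So a Moebius map fixing
  infinity is a similarity. If a self-map of the ball fixes the origin, its conjugate by the inversion
  in the unit sphere fixes infinity and maps the closed ball onto itself, hence preserves the norm;
  so the map itself preserves the norm (lemma \<open>moebius_ball_fixing_origin_norm\<close>). An
  arbitrary self-map is reduced to this one by the reflections that preserve the ball, for
  which the invariance of \<open>\<rho>\<close> is a computation.

  For sharpness, \<open>u\<close> equals \<open>\<rho>\<close> at pairs symmetric about the origin, and is close to \<open>3\<rho>\<close> at
  radial pairs of nearby points close to the boundary. The reflection exchanging the
  origin with the point \<open>(1 - s) e\<close> carries the symmetric pair \<open>s e, - s e\<close> to a radial pair near the
  boundary, and the ratio of the two values of \<open>u\<close> tends to \<open>3\<close> as \<open>s\<close> tends to \<open>0\<close>. The reflection is an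
  involution, so read backwards the same pairs show that \<open>1/3\<close> is the best constant as well.
\<close>

section \<open>Moebius maps and the extended distance\<close>

text \<open>Infinity enters with a normalisation: dividing \<open>|z - w|\<close> by the norm of each argument that tends to
  infinity leaves the limits \<open>1\<close> (one argument) and \<open>0\<close> (both). A different scaling at infinity would only
  change the multiplier \<open>\<mu>\<close> below.\<close>

fun ext_dist :: "'a::euclidean_space option \<Rightarrow> 'a option \<Rightarrow> real" where
  "ext_dist (Some x) (Some y) = norm (x - y)"
| "ext_dist None None = 0"
| "ext_dist _ _ = 1"

lemma norm_diff_inversion:
  fixes x y :: "'a::real_inner"
  assumes "x \<noteq> 0" "y \<noteq> 0"
  shows "norm ((c / (norm x)\<^sup>2) *\<^sub>R x - (c / (norm y)\<^sup>2) *\<^sub>R y) = \<bar>c\<bar> * norm (x - y) / (norm x * norm y)"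
proof -
  define X where "X = (norm x)\<^sup>2"
  define Y where "Y = (norm y)\<^sup>2"
  have pos: "X \<noteq> 0" "Y \<noteq> 0" using assms by (auto simp: X_def Y_def)
  have xx: "x \<bullet> x = X" "y \<bullet> y = Y" by (simp_all add: X_def Y_def power2_norm_eq_inner)
  have "(norm ((c / X) *\<^sub>R x - (c / Y) *\<^sub>R y))\<^sup>2 = c\<^sup>2 / X + c\<^sup>2 / Y - 2 * c\<^sup>2 * (x \<bullet> y) / (X * Y)"
    unfolding power2_norm_eq_inner using pos
    by (simp add: inner_diff_left inner_diff_right xx inner_commute[of y x] field_simps power2_eq_square)
  also have "\<dots> = c\<^sup>2 * (X + Y - 2 * (x \<bullet> y)) / (X * Y)"
    using pos by (simp add: field_simps)
  also have "X + Y - 2 * (x \<bullet> y) = (norm (x - y))\<^sup>2"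
    unfolding power2_norm_eq_inner by (simp add: inner_diff_left inner_diff_right xx inner_commute[of y x])
  also have "c\<^sup>2 * (norm (x - y))\<^sup>2 / (X * Y) = (\<bar>c\<bar> * norm (x - y) / (norm x * norm y))\<^sup>2"
    by (simp add: X_def Y_def power_mult_distrib power_divide)
  finally show ?thesis
    unfolding X_def Y_def by (rule power2_eq_imp_eq) auto
qed

text \<open>The multiplier of an inversion in the sphere with center \<open>a\<close> and radius \<open>r\<close> at \<open>x\<close> is \<open>r / |x - a|\<close>. Its values
  at \<open>a\<close> and at infinity are forced by the pairs that contain one of these two points.\<close>

lemma ext_dist_sphere_reflection:
  assumes "r > 0"
  shows "\<exists>\<mu>. (\<forall>z. \<mu> z > 0) \<and>
    (\<forall>z w. ext_dist (sphere_reflection a r z) (sphere_reflection a r w) = \<mu> z * \<mu> w * ext_dist z w)"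
proof -
  define \<mu> where "\<mu> z = (case z of None \<Rightarrow> r | Some x \<Rightarrow> if x = a then 1 / r else r / norm (x - a))" for z
  have "\<mu> z > 0" for z
    using assms by (auto simp: \<mu>_def split: option.splits)
  moreover have "ext_dist (sphere_reflection a r z) (sphere_reflection a r w) = \<mu> z * \<mu> w * ext_dist z w" for z w
  proof (cases z; cases w)
    fix x y assume zw: "z = Some x" "w = Some y"
    show ?thesis
      using assms norm_diff_inversion[of "x - a" "y - a" "r\<^sup>2"]
      by (auto simp: zw \<mu>_def sphere_reflection_def field_simps power2_eq_square norm_minus_commute)
  qed (use assms in \<open>auto simp: \<mu>_def sphere_reflection_def power2_eq_square\<close>)
  ultimately show ?thesis by blast
qed

lemma norm_hyperplane_reflection:
  fixes a x y :: "'a::real_inner"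
  assumes "a \<noteq> 0"
  shows "norm ((x - (2 * (a \<bullet> x - b) / (a \<bullet> a)) *\<^sub>R a) - (y - (2 * (a \<bullet> y - b) / (a \<bullet> a)) *\<^sub>R a)) = norm (x - y)"
proof -
  define k where "k = 2 * (a \<bullet> (x - y)) / (a \<bullet> a)"
  have k: "k * (a \<bullet> a) = 2 * (a \<bullet> (x - y))" using assms by (simp add: k_def)
  have "(x - (2 * (a \<bullet> x - b) / (a \<bullet> a)) *\<^sub>R a) - (y - (2 * (a \<bullet> y - b) / (a \<bullet> a)) *\<^sub>R a)
      = (x - y) - k *\<^sub>R a"
    by (simp add: k_def algebra_simps diff_divide_distrib inner_diff_right flip: scaleR_add_left)
  moreover have "((x - y) - k *\<^sub>R a) \<bullet> ((x - y) - k *\<^sub>R a) = (x - y) \<bullet> (x - y)"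
  proof -
    have "((x - y) - k *\<^sub>R a) \<bullet> ((x - y) - k *\<^sub>R a)
      = (x - y) \<bullet> (x - y) - 2 * k * (a \<bullet> (x - y)) + k * (k * (a \<bullet> a))"
      by (simp only: inner_diff_left inner_diff_right inner_scaleR_left inner_scaleR_right)
         (simp add: algebra_simps inner_commute)
    then show ?thesis unfolding k by simp
  qed
  ultimately show ?thesis unfolding norm_eq_sqrt_inner by presburger
qed

lemma ext_dist_hyperplane_reflection:
  assumes "a \<noteq> 0"
  shows "ext_dist (hyperplane_reflection a b z) (hyperplane_reflection a b w) = ext_dist z w"
  using norm_hyperplane_reflection[OF assms, of _ b]
  by (cases z; cases w) (auto simp: hyperplane_reflection_def)

text \<open>A map of this kind preserves all cross-ratios. Because the extended distance is defined at
  infinity, multipliers multiply along a composition even if an intermediate map sends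
  a finite point to infinity.\<close>

lemma moebius_ext_dist:
  assumes "moebius f"
  shows "\<exists>\<mu>. (\<forall>z. \<mu> z > 0) \<and> (\<forall>z w. ext_dist (f z) (f w) = \<mu> z * \<mu> w * ext_dist z w)"
  using assms
proof induction
  case moebius_id
  show ?case by (rule exI[of _ "\<lambda>_. 1"]) simp
next
  case (moebius_sphere f r a)
  then obtain \<mu> where "\<And>z. \<mu> z > 0" "\<And>z w. ext_dist (f z) (f w) = \<mu> z * \<mu> w * ext_dist z w" by blast
  moreover obtain \<nu> where "\<And>z. \<nu> z > 0"
    "\<And>z w. ext_dist (sphere_reflection a r z) (sphere_reflection a r w) = \<nu> z * \<nu> w * ext_dist z w"
    using ext_dist_sphere_reflection[OF \<open>r > 0\<close>] by blast
  ultimately show ?case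
    by (intro exI[of _ "\<lambda>z. \<nu> (f z) * \<mu> z"]) (simp add: mult_ac)
next
  case (moebius_hyperplane f a b)
  then show ?case by (simp add: ext_dist_hyperplane_reflection)
qed

section \<open>Composition and inverses\<close>

lemma sphere_reflection_involution:
  assumes "r > 0"
  shows "sphere_reflection a r (sphere_reflection a r z) = z"
proof (cases "z = None \<or> z = Some a")
  case True
  then show ?thesis by (auto simp: sphere_reflection_def)
next
  case False
  then obtain x where z: "z = Some x" "x \<noteq> a" by auto
  define c where "c = r\<^sup>2 / (norm (x - a))\<^sup>2"
  have "c > 0" using assms z by (simp add: c_def)
  have "r\<^sup>2 / (norm (c *\<^sub>R (x - a)))\<^sup>2 * c = r\<^sup>2 / (c * (norm (x - a))\<^sup>2)"
    using \<open>c > 0\<close> by (simp add: power_mult_distrib power2_eq_square)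
  also have "\<dots> = 1" using assms z by (simp add: c_def)
  finally show ?thesis
    using assms \<open>c > 0\<close> z by (simp add: sphere_reflection_def flip: c_def)
qed

lemma hyperplane_reflection_involution:
  assumes "a \<noteq> 0"
  shows "hyperplane_reflection a b (hyperplane_reflection a b z) = z"
proof (cases z)
  case (Some x)
  define k where "k = 2 * (a \<bullet> x - b) / (a \<bullet> a)"
  have k': "2 * (a \<bullet> (x - k *\<^sub>R a) - b) / (a \<bullet> a) = - k"
  proof -
    have "k * (a \<bullet> a) = 2 * (a \<bullet> x - b)" using assms by (simp add: k_def)
    then have "2 * (a \<bullet> (x - k *\<^sub>R a) - b) = - k * (a \<bullet> a)" by (simp add: inner_diff_right)
    then show ?thesis using assms by (simp only: nonzero_mult_div_cancel_right) simp
  qed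
  show ?thesis
    unfolding Some hyperplane_reflection_def option.map k_def[symmetric] k' by simp
qed (simp add: hyperplane_reflection_def)

lemma moebius_bij: "moebius f \<Longrightarrow> bij f"
proof (induction rule: moebius.induct)
  case (moebius_sphere f r a)
  then have "bij (sphere_reflection a r)"
    by (intro o_bij[of "sphere_reflection a r"]) (auto simp: sphere_reflection_involution)
  with moebius_sphere show ?case by (intro bij_comp)
next
  case (moebius_hyperplane f a b)
  then have "bij (hyperplane_reflection a b)"
    by (intro o_bij[of "hyperplane_reflection a b"]) (auto simp: hyperplane_reflection_involution)
  with moebius_hyperplane show ?case by (intro bij_comp)
qed (rule bij_id)

lemma moebius_comp: "moebius f \<Longrightarrow> moebius g \<Longrightarrow> moebius (f \<circ> g)"
  by (induction rule: moebius.induct) (auto simp: comp_assoc intro: moebius.intros)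

lemma moebius_sphere_reflection: "r > 0 \<Longrightarrow> moebius (sphere_reflection a r)"
  using moebius_sphere[OF moebius_id] by simp

lemma moebius_self_maps_comp:
  "f \<in> moebius_self_maps D \<Longrightarrow> g \<in> moebius_self_maps D \<Longrightarrow> f \<circ> g \<in> moebius_self_maps D"
  unfolding moebius_self_maps_def mem_Collect_eq
  by (metis image_comp moebius_comp)

lemma moebius_self_maps_Some:
  assumes "f \<in> moebius_self_maps D" "x \<in> D"
  obtains x' where "x' \<in> D" "f (Some x) = Some x'"
  using assms by (auto simp: moebius_self_maps_def)

text \<open>Pairing a finite point with infinity shows that the multiplier is constant on the finite points.\<close>

lemma moebius_fixing_infinity_similarity:
  assumes "moebius f" "f None = None"
  obtains h k where "k > 0" "\<And>x. f (Some x) = Some (h x)" "\<And>x y. norm (h x - h y) = k * norm (x - y)"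
proof -
  obtain \<mu> where \<mu>: "\<And>z. \<mu> z > 0" "\<And>z w. ext_dist (f z) (f w) = \<mu> z * \<mu> w * ext_dist z w"
    using moebius_ext_dist[OF assms(1)] by blast
  have "\<exists>y. f (Some x) = Some y" for x
    using moebius_bij[OF assms(1)] assms(2) by (metis bij_pointE option.distinct(1) option.exhaust)
  then obtain h where h: "\<And>x. f (Some x) = Some (h x)" by metis
  have "\<mu> (Some x) = 1 / \<mu> None" for x
    using \<mu>(2)[of "Some x" None] \<mu>(1)[of None] by (simp add: h assms(2) field_simps)
  then have "norm (h x - h y) = (1 / \<mu> None)\<^sup>2 * norm (x - y)" for x y
    using \<mu>(2)[of "Some x" "Some y"] by (simp add: h power2_eq_square)
  moreover have "(1 / \<mu> None)\<^sup>2 > 0" using \<mu>(1)[of None] by simp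
  ultimately show thesis using that h by blast
qed

section \<open>Self-maps of the ball fixing the origin\<close>

text \<open>The diameter of the closed ball forces the ratio \<open>k = 1\<close>. Then \<open>h\<close> sends an antipodal pair
  to points at distance \<open>2\<close> in the ball, which by the parallelogram law are again antipodal unit vectors.
  The point \<open>h 0\<close> is at distance \<open>1\<close> from both, so it is their midpoint \<open>0\<close>.\<close>

lemma similarity_unit_cball_isometry:
  fixes h :: "'a::euclidean_space \<Rightarrow> 'a"
  assumes sim: "\<And>x y. norm (h x - h y) = k * norm (x - y)"
    and img: "h ` cball 0 1 = cball 0 1"
  shows "norm (h x) = norm x"
proof -
  obtain e :: 'a where e: "norm e = 1" using norm_Basis nonempty_Basis by blast
  have diam: "norm (u - v) \<le> 2" if "u \<in> cball 0 1" "v \<in> cball 0 1" for u v :: 'a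
    using that norm_triangle_ineq4[of u v] by simp
  have e2: "norm (e - - e) = 2" using e by (simp flip: scaleR_2)
  define u where "u = h e"
  define v where "v = h (- e)"
  have uv: "u \<in> cball 0 1" "v \<in> cball 0 1"
    using img e by (auto simp: u_def v_def)
  have "k \<le> 1"
    using diam[OF uv] sim[of e "- e"] e2 by (simp add: u_def v_def)
  moreover have "k \<ge> 1"
  proof -
    have "e \<in> h ` cball 0 1" "- e \<in> h ` cball 0 1" using e by (simp_all add: img)
    then obtain u' v' where *: "u' \<in> cball 0 1" "v' \<in> cball 0 1" "h u' = e" "h v' = - e" by (metis imageE)
    have "2 = k * norm (u' - v')" using sim[of u' v'] * e2 by simp
    moreover have "0 \<le> k" using sim[of e "- e"] norm_ge_zero[of "h e - h (- e)"] e2 by simp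
    ultimately have "2 \<le> k * 2" using mult_left_mono[OF diam[OF *(1,2)], of k] by simp
    then show ?thesis by simp
  qed
  ultimately have iso: "norm (h x - h y) = norm (x - y)" for x y using sim by simp
  have nuv: "norm (u - v) = 2" using iso[of e "- e"] e2 by (simp add: u_def v_def)
  then have "(norm (u - v))\<^sup>2 = 4" by simp
  moreover have "(norm (u + v))\<^sup>2 + (norm (u - v))\<^sup>2 = 2 * (norm u)\<^sup>2 + 2 * (norm v)\<^sup>2"
    by (simp add: power2_norm_eq_inner algebra_simps)
  moreover have "(norm u)\<^sup>2 \<le> 1" "(norm v)\<^sup>2 \<le> 1" using uv by (simp_all add: power_le_one)
  ultimately have "(norm (u + v))\<^sup>2 \<le> 0" by linarith
  then have v: "v = - u" by (simp add: add_eq_0_iff2)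
  have "norm u = 1" using nuv by (simp add: v flip: scaleR_2)
  have "norm (h 0 - u) = 1" "norm (h 0 + u) = 1"
    using iso[of 0 e] iso[of 0 "- e"] e v by (simp_all add: u_def v_def)
  moreover have "(norm (h 0 + u))\<^sup>2 + (norm (h 0 - u))\<^sup>2 = 2 * (norm (h 0))\<^sup>2 + 2 * (norm u)\<^sup>2"
    by (simp add: power2_norm_eq_inner algebra_simps)
  ultimately have "h 0 = 0" using \<open>norm u = 1\<close> by simp
  then show ?thesis using iso[of x 0] by simp
qed

text \<open>The complement is taken in the extended space, so it contains infinity, the image of the origin.\<close>

lemma unit_inversion_image_cball:
  "sphere_reflection 0 1 ` (Some ` cball 0 1) = - (Some ` ball (0::'a::euclidean_space) 1)"
proof -
  let ?J = "sphere_reflection (0::'a) 1"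
  have J: "?J z \<in> - (Some ` ball 0 1) \<longleftrightarrow> z \<in> Some ` cball 0 1" for z
    by (cases z) (auto simp: sphere_reflection_def image_iff power2_eq_square field_simps)
  show ?thesis
  proof (intro equalityI subsetI)
    fix z assume "z \<in> - (Some ` ball (0::'a) 1)"
    then have "?J z \<in> Some ` cball 0 1"
      using J[of "?J z"] by (simp add: sphere_reflection_involution)
    then show "z \<in> ?J ` (Some ` cball 0 1)"
      by (metis image_eqI sphere_reflection_involution zero_less_one)
  next
    fix z assume "z \<in> ?J ` (Some ` cball 0 1)"
    then obtain u where "u \<in> Some ` cball 0 1" "z = ?J u" by (rule imageE)
    then show "z \<in> - (Some ` ball 0 1)" using J[of u] by simp
  qed
qed

text \<open>The conjugate of \<open>g\<close> by the inversion \<open>J\<close> fixes infinity because \<open>g\<close> fixes \<open>J \<infinity> = 0\<close>, and it maps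
  the closed ball onto itself because the bijection \<open>g\<close> preserves the complement of the open ball. So it is a
  norm-preserving similarity, and \<open>|J z| = 1 / |z|\<close> carries this back to \<open>g\<close>.\<close>

lemma moebius_ball_fixing_origin_norm:
  fixes g :: "'a::euclidean_space option \<Rightarrow> 'a option"
  assumes g: "g \<in> moebius_self_maps (ball 0 1)" and 0: "g (Some 0) = Some 0"
    and w: "g (Some w) = Some w'"
  shows "norm w' = norm w"
proof (cases "w = 0")
  case True
  then show ?thesis using 0 w by simp
next
  case False
  let ?J = "sphere_reflection (0::'a) 1"
  have JJ: "?J (?J z) = z" for z by (simp add: sphere_reflection_involution)
  define G where "G = ?J \<circ> g \<circ> ?J"
  have mg: "moebius g" and gB: "g ` (Some ` ball 0 1) = Some ` ball 0 1"
    using g by (auto simp: moebius_self_maps_def)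
  have mG: "moebius G"
    unfolding G_def by (intro moebius_comp moebius_sphere_reflection mg) simp_all
  have "G None = None" by (simp add: G_def sphere_reflection_def 0)
  then obtain h k where hk: "\<And>x. G (Some x) = Some (h x)" "\<And>x y. norm (h x - h y) = k * norm (x - y)"
    using moebius_fixing_infinity_similarity[OF mG] by metis
  have "Some ` h ` cball 0 1 = G ` Some ` cball 0 1"
    by (simp add: image_image hk)
  also have "\<dots> = ?J ` g ` (- (Some ` ball 0 1))"
    unfolding G_def image_comp[symmetric] unit_inversion_image_cball ..
  also have "g ` (- (Some ` ball 0 1)) = - (Some ` ball 0 1)"
    using moebius_bij[OF mg] by (simp add: bij_image_Compl_eq gB)
  also have "?J ` (- (Some ` ball 0 1)) = Some ` cball 0 1"
    by (simp add: image_image JJ flip: unit_inversion_image_cball)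
  finally have "h ` cball 0 1 = cball 0 1"
    by (simp add: inj_image_eq_iff)
  then have nh: "norm (h x) = norm x" for x
    using similarity_unit_cball_isometry[of h k] hk(2) by blast
  have Jw: "?J (Some w) = Some (w /\<^sub>R (norm w)\<^sup>2)"
    using False by (simp add: sphere_reflection_def inverse_eq_divide)
  have "w' \<noteq> 0"
    using False w 0 moebius_bij[OF mg] by (metis bij_pointE option.inject)
  then have "?J (Some w') = Some (w' /\<^sub>R (norm w')\<^sup>2)"
    by (simp add: sphere_reflection_def inverse_eq_divide)
  moreover have "G (?J (Some w)) = ?J (Some w')"
    by (simp add: G_def JJ w)
  ultimately have "h (w /\<^sub>R (norm w)\<^sup>2) = w' /\<^sub>R (norm w')\<^sup>2"
    by (simp add: Jw hk)
  then have "norm (w' /\<^sub>R (norm w')\<^sup>2) = norm (w /\<^sub>R (norm w)\<^sup>2)"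
    using nh by metis
  then show ?thesis
    using False \<open>w' \<noteq> 0\<close> by (simp add: power2_eq_square field_simps)
qed

section \<open>Invariance of the hyperbolic metric\<close>

text \<open>The hyperbolic metric of curvature \<open>-1\<close> on the unit ball.\<close>

definition hyp_dist :: "'a::real_inner \<Rightarrow> 'a \<Rightarrow> real" where
  "hyp_dist x y = 2 * arsinh (norm (x - y) / sqrt ((1 - (norm x)\<^sup>2) * (1 - (norm y)\<^sup>2)))"

text \<open>For \<open>0 < |p| < 1\<close> this is the reflection in the sphere orthogonal to the unit sphere that exchanges
  \<open>0\<close> and \<open>p\<close>: the center is the inverse point \<open>a\<close> of \<open>p\<close>, and orthogonality means \<open>r\<^sup>2 = |a|\<^sup>2 - 1\<close>.\<close>

definition ball_reflection :: "'a::euclidean_space \<Rightarrow> 'a option \<Rightarrow> 'a option" where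
  "ball_reflection p = sphere_reflection (p /\<^sub>R (norm p)\<^sup>2) (sqrt (1 / (norm p)\<^sup>2 - 1))"

text \<open>Everything follows from the identity \<open>1 - |S x|\<^sup>2 = (r / |x - a|)\<^sup>2 (1 - |x|\<^sup>2)\<close>, which holds because
  the reflecting sphere is orthogonal to the unit sphere: the same multipliers \<open>r / |x - a|\<close> occur in
  \<open>|S x - S y|\<close>, so they cancel in the hyperbolic metric.\<close>

lemma ball_reflection:
  fixes p :: "'a::euclidean_space"
  assumes p: "p \<in> ball 0 1" "p \<noteq> 0"
  shows ball_reflection_self_map: "ball_reflection p \<in> moebius_self_maps (ball 0 1)"
    and ball_reflection_involution: "ball_reflection p (ball_reflection p z) = z"
    and ball_reflection_0: "ball_reflection p (Some 0) = Some p"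
    and hyp_dist_ball_reflection: "\<lbrakk>x \<in> ball 0 1; y \<in> ball 0 1\<rbrakk> \<Longrightarrow>
      hyp_dist (fin_app (ball_reflection p) x) (fin_app (ball_reflection p) y) = hyp_dist x y"
proof -
  define a where "a = p /\<^sub>R (norm p)\<^sup>2"
  define r where "r = sqrt (1 / (norm p)\<^sup>2 - 1)"
  have np: "0 < norm p" "norm p < 1" using p by auto
  have na: "norm a = 1 / norm p" using np by (simp add: a_def power2_eq_square field_simps)
  have "(norm p)\<^sup>2 < 1" using np by (simp add: power_less_one_iff)
  then have r2: "r\<^sup>2 = (norm a)\<^sup>2 - 1" and r: "r > 0"
    using np by (auto simp: r_def na power_divide field_simps)
  have R: "ball_reflection p = sphere_reflection a r" by (simp add: ball_reflection_def a_def r_def)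
  show invol: "ball_reflection p (ball_reflection p z) = z" for z
    by (simp add: R sphere_reflection_involution r)
  define S where "S x = a + (r\<^sup>2 / (norm (x - a))\<^sup>2) *\<^sub>R (x - a)" for x
  have xa: "x \<noteq> a" if "x \<in> ball 0 1" for x
  proof -
    have "norm a > 1" using np by (simp add: na)
    then show ?thesis using that by auto
  qed
  have RS: "ball_reflection p (Some x) = Some (S x)" if "x \<in> ball 0 1" for x
    using xa[OF that] by (simp add: R sphere_reflection_def S_def)
  have S_norm: "1 - (norm (S x))\<^sup>2 = (r\<^sup>2 / (norm (x - a))\<^sup>2) * (1 - (norm x)\<^sup>2)" if "x \<in> ball 0 1" for x
  proof -
    define q where "q = r\<^sup>2 / (norm (x - a))\<^sup>2"
    have q: "q * (norm (x - a))\<^sup>2 = r\<^sup>2" using xa[OF that] by (simp add: q_def)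
    have "(norm (S x))\<^sup>2 = (norm a)\<^sup>2 + 2 * q * (a \<bullet> (x - a)) + q * (q * (norm (x - a))\<^sup>2)"
      unfolding S_def unfolding q_def[symmetric] unfolding power2_norm_eq_inner
      by (simp only: inner_add_left inner_add_right inner_scaleR_left inner_scaleR_right)
         (simp add: algebra_simps inner_commute)
    also have "\<dots> = 1 + q * (norm (x - a))\<^sup>2 + 2 * q * (a \<bullet> (x - a)) + q * ((norm a)\<^sup>2 - 1)"
      unfolding q r2 by simp
    also have "\<dots> = 1 - q * (1 - (norm x)\<^sup>2)"
      unfolding power2_norm_eq_inner
      by (simp add: algebra_simps inner_commute)
    finally show ?thesis by (simp add: q_def)
  qed
  have S_ball: "S x \<in> ball 0 1" if "x \<in> ball 0 1" for x
  proof -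
    have "(norm x)\<^sup>2 < 1" using that by (simp add: power_less_one_iff)
    then have "1 - (norm (S x))\<^sup>2 > 0" unfolding S_norm[OF that] using r xa[OF that] by simp
    then show ?thesis by (simp add: power_less_one_iff)
  qed
  have sub: "ball_reflection p ` (Some ` ball 0 1) \<subseteq> Some ` ball 0 1"
    using RS S_ball by auto
  have "Some ` ball 0 1 \<subseteq> ball_reflection p ` (Some ` ball 0 1)"
  proof
    fix z :: "'a option" assume "z \<in> Some ` ball 0 1"
    then have "ball_reflection p z \<in> Some ` ball 0 1" using sub by blast
    then show "z \<in> ball_reflection p ` (Some ` ball 0 1)" by (metis image_eqI invol)
  qed
  then show "ball_reflection p \<in> moebius_self_maps (ball 0 1)"
    using sub r by (auto simp: moebius_self_maps_def R moebius_sphere_reflection)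
  show "ball_reflection p (Some 0) = Some p"
  proof -
    have "S 0 = (1 - r\<^sup>2 / (norm a)\<^sup>2) *\<^sub>R a" by (simp add: S_def scaleR_diff_left)
    also have "1 - r\<^sup>2 / (norm a)\<^sup>2 = (norm p)\<^sup>2"
      unfolding r2 using np by (simp add: na power_divide field_simps)
    also have "(norm p)\<^sup>2 *\<^sub>R a = p" using np by (simp add: a_def)
    finally show ?thesis using RS[of 0] by simp
  qed
  show "hyp_dist (fin_app (ball_reflection p) x) (fin_app (ball_reflection p) y) = hyp_dist x y"
    if x: "x \<in> ball 0 1" and y: "y \<in> ball 0 1"
  proof -
    define q where "q = r\<^sup>2 / (norm (x - a) * norm (y - a))"
    have q: "q > 0" using r xa[OF x] xa[OF y] by (simp add: q_def)
    have dist: "norm (S x - S y) = q * norm (x - y)"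
      using norm_diff_inversion[of "x - a" "y - a" "r\<^sup>2"] xa x y by (simp add: S_def q_def)
    have prod: "(1 - (norm (S x))\<^sup>2) * (1 - (norm (S y))\<^sup>2) = q\<^sup>2 * ((1 - (norm x)\<^sup>2) * (1 - (norm y)\<^sup>2))"
      unfolding S_norm[OF x] S_norm[OF y]
      by (simp add: q_def power_divide power_mult_distrib power2_eq_square mult_ac)
    have root: "sqrt (q\<^sup>2 * P) = q * sqrt P" for P using q by (simp add: real_sqrt_mult)
    show ?thesis
      unfolding hyp_dist_def RS[OF x] RS[OF y] option.sel dist prod root using q by simp
  qed
qed

lemma ball_isometry_from_origin:
  fixes p :: "'a::euclidean_space"
  assumes "p \<in> ball 0 1"
  shows "\<exists>T \<in> moebius_self_maps (ball 0 1). T (Some 0) = Some p \<and> (\<forall>z. T (T z) = z) \<and>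
    (\<forall>u \<in> ball 0 1. \<forall>v \<in> ball 0 1. hyp_dist (fin_app T u) (fin_app T v) = hyp_dist u v)"
proof (cases "p = 0")
  case True
  then show ?thesis by (intro bexI[of _ id]) (auto simp: moebius_self_maps_def moebius_id)
next
  case False
  then show ?thesis using ball_reflection[OF assms] by blast
qed

text \<open>Moving \<open>x\<close> and its image to the origin, before and after \<open>f\<close>, reduces the claim to a map \<open>g\<close> that fixes the origin;
  \<open>\<rho>(0, w)\<close> depends on \<open>|w|\<close> only.\<close>

lemma hyp_dist_moebius:
  fixes f :: "'a::euclidean_space option \<Rightarrow> 'a option"
  assumes f: "f \<in> moebius_self_maps (ball 0 1)" and x: "x \<in> ball 0 1" and y: "y \<in> ball 0 1"
  shows "hyp_dist (fin_app f x) (fin_app f y) = hyp_dist x y"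
proof -
  obtain x' where x': "x' \<in> ball 0 1" "f (Some x) = Some x'" using moebius_self_maps_Some[OF f x] .
  obtain y' where y': "y' \<in> ball 0 1" "f (Some y) = Some y'" using moebius_self_maps_Some[OF f y] .
  obtain S where S: "S \<in> moebius_self_maps (ball 0 1)" "S (Some 0) = Some x" "\<And>z. S (S z) = z"
    "\<And>u v. \<lbrakk>u \<in> ball 0 1; v \<in> ball 0 1\<rbrakk> \<Longrightarrow> hyp_dist (fin_app S u) (fin_app S v) = hyp_dist u v"
    using ball_isometry_from_origin[OF x] by blast
  obtain T where T: "T \<in> moebius_self_maps (ball 0 1)" "T (Some 0) = Some x'" "\<And>z. T (T z) = z"
    "\<And>u v. \<lbrakk>u \<in> ball 0 1; v \<in> ball 0 1\<rbrakk> \<Longrightarrow> hyp_dist (fin_app T u) (fin_app T v) = hyp_dist u v"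
    using ball_isometry_from_origin[OF x'(1)] by blast
  obtain w where w: "w \<in> ball 0 1" "S (Some y) = Some w" using moebius_self_maps_Some[OF S(1) y] .
  obtain w' where w': "w' \<in> ball 0 1" "T (Some y') = Some w'" using moebius_self_maps_Some[OF T(1) y'(1)] .
  define g where "g = T \<circ> f \<circ> S"
  have "g \<in> moebius_self_maps (ball 0 1)"
    unfolding g_def by (intro moebius_self_maps_comp f S T)
  moreover have "g (Some 0) = Some 0" using T(3)[of "Some 0"] by (simp add: g_def S x' T)
  moreover have "g (Some w) = Some w'" using S(3)[of "Some y"] by (simp add: g_def w y' w')
  ultimately have "norm w' = norm w" by (rule moebius_ball_fixing_origin_norm)
  then have "hyp_dist 0 w' = hyp_dist 0 w" by (simp add: hyp_dist_def)
  moreover have "hyp_dist 0 w' = hyp_dist x' y'"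
    using T(4)[OF x'(1) y'(1)] T(3)[of "Some 0"] by (simp add: T(2) w')
  moreover have "hyp_dist 0 w = hyp_dist x y"
    using S(4)[OF x y] S(3)[of "Some 0"] by (simp add: S(2) w)
  ultimately show ?thesis by (simp add: x' y')
qed

section \<open>Comparison of the Gromov and the hyperbolic metric\<close>

lemma infdist_unit_sphere:
  fixes x :: "'a::euclidean_space"
  assumes "x \<in> ball 0 1"
  shows "infdist x (frontier (ball 0 1)) = 1 - norm x"
proof -
  obtain e :: 'a where e: "norm e = 1" "x = norm x *\<^sub>R e"
  proof (cases "x = 0")
    case True
    then show ?thesis using that norm_Basis nonempty_Basis by fastforce
  next
    case False
    then show ?thesis using that[of "x /\<^sub>R norm x"] by simp
  qed
  have fr: "frontier (ball (0::'a) 1) = sphere 0 1" by (simp add: frontier_ball)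
  have "dist x e = norm ((norm x - 1) *\<^sub>R e)"
    using e by (metis dist_norm scaleR_diff_left scaleR_one)
  also have "\<dots> = 1 - norm x" using e assms by simp
  finally have "infdist x (sphere 0 1) \<le> 1 - norm x"
    using infdist_le[of e "sphere 0 1" x] e by simp
  moreover have "1 - norm x \<le> infdist x (sphere 0 1)"
  proof -
    have "1 - norm x \<le> dist x u" if "u \<in> sphere 0 1" for u
      using that norm_triangle_ineq2[of u x] by (simp add: dist_norm norm_minus_commute)
    moreover have "sphere (0::'a) 1 \<noteq> {}" using e by auto
    ultimately show ?thesis by (auto simp: infdist_def intro!: cINF_greatest)
  qed
  ultimately show ?thesis by (simp add: fr)
qed

lemma gromov_dist_ball:
  fixes x y :: "'a::euclidean_space"
  assumes "x \<in> ball 0 1" "y \<in> ball 0 1"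
  shows "gromov_dist (ball 0 1) x y =
    2 * ln ((norm (x - y) + max (1 - norm x) (1 - norm y)) / sqrt ((1 - norm x) * (1 - norm y)))"
  by (simp only: gromov_dist_def Let_def infdist_unit_sphere[OF assms(1)] infdist_unit_sphere[OF assms(2)])


lemma exp_arsinh_divide:
  fixes t R :: real
  assumes "R > 0"
  shows "exp (arsinh (t / R)) = (t + sqrt (t\<^sup>2 + R\<^sup>2)) / R"
proof -
  have "sqrt ((t / R)\<^sup>2 + 1) = sqrt ((t\<^sup>2 + R\<^sup>2) / R\<^sup>2)"
    using assms by (simp add: power_divide field_simps)
  then have "sqrt ((t / R)\<^sup>2 + 1) = sqrt (t\<^sup>2 + R\<^sup>2) / R"
    using assms by (simp add: real_sqrt_divide)
  moreover have "t / R + sqrt ((t / R)\<^sup>2 + 1) > 0" by (rule arsinh_real_aux)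
  ultimately show ?thesis by (simp add: arsinh_real_def add_divide_distrib)
qed

text \<open>With \<open>a = |x|\<close>, \<open>b = |y|\<close> and \<open>t = |x - y|\<close>, the quotient \<open>Q\<close> is \<open>exp (u/2)\<close> and \<open>E\<close> is \<open>exp (\<rho>/2)\<close>,
  that is \<open>E = (t + A) / R\<close> with \<open>R\<^sup>2 = (1 - a\<^sup>2) (1 - b\<^sup>2)\<close> and \<open>A\<^sup>2 = t\<^sup>2 + R\<^sup>2\<close>. The lower bound is an equality for
  \<open>a = b\<close>, \<open>t = 2 a\<close>, that is for \<open>y = - x\<close>. For the upper bound, \<open>Q\<close> is the product of
  \<open>sqrt ((1 - a) / (1 - b))\<close>, which is at most \<open>E\<close>, and \<open>1 + t / (1 - a)\<close>, which is at most \<open>E\<^sup>2\<close>.\<close>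

lemma gromov_quotient_bounds:
  fixes a b t :: real
  assumes ab: "0 \<le> a" "a \<le> b" "b < 1" and t: "b - a \<le> t" "t \<le> a + b"
  defines "Q \<equiv> (t + (1 - a)) / sqrt ((1 - a) * (1 - b))"
    and "E \<equiv> exp (arsinh (t / sqrt ((1 - a\<^sup>2) * (1 - b\<^sup>2))))"
  shows "E \<le> Q" and "Q \<le> E ^ 3"
proof -
  define g where "g = sqrt ((1 - a) * (1 - b))"
  define K where "K = sqrt ((1 + a) * (1 + b))"
  define R where "R = sqrt ((1 - a\<^sup>2) * (1 - b\<^sup>2))"
  define A where "A = sqrt (t\<^sup>2 + R\<^sup>2)"
  have g: "g > 0" using ab by (simp add: g_def)
  have K2: "K\<^sup>2 = (1 + a) * (1 + b)" using ab by (simp add: K_def)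
  have g2: "g\<^sup>2 = (1 - a) * (1 - b)" using ab by (simp add: g_def)
  have R: "R = g * K"
    by (simp add: R_def g_def K_def power2_eq_square algebra_simps flip: real_sqrt_mult)
  have K_lower: "1 + a \<le> K"
    unfolding K_def using ab by (intro real_le_rsqrt) (simp add: power2_eq_square mult_left_mono)
  have K_upper: "K \<le> 1 + b"
    unfolding K_def using ab by (intro real_le_lsqrt) (auto simp: power2_eq_square mult_right_mono)
  have K: "K > 0" using K_lower ab by simp
  have t0: "0 \<le> t" using ab t by simp
  have R2: "R\<^sup>2 = g\<^sup>2 * K\<^sup>2" by (simp add: R power_mult_distrib)
  have R0: "R > 0" using g K by (simp add: R)
  have E: "E = (t + A) / R"
    using exp_arsinh_divide[OF R0] by (simp add: E_def A_def R_def)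
  have A2: "A\<^sup>2 = t\<^sup>2 + R\<^sup>2" by (simp add: A_def)

  \<comment> \<open>The inequality \<open>E \<le> Q\<close> with the common factor \<open>1 / g\<close> cancelled.\<close>
  have "t + A \<le> (t + (1 - a)) * K"
  proof -
    define v where "v = t * (K - 1) + (1 - a) * K"
    have "K \<ge> t"
    proof -
      have "a * a \<le> a * 1" "b * b \<le> b * 1" "a * b \<le> 1 * 1"
        using ab by (intro mult_mono; simp)+
      then have "(a + b)\<^sup>2 \<le> K\<^sup>2" unfolding K2 by (simp add: power2_eq_square algebra_simps)
      then have "a + b \<le> K" by (rule power2_le_imp_le) (use K in simp)
      then show ?thesis using t by simp
    qed
    \<comment> \<open>This expression is \<open>(v\<^sup>2 - A\<^sup>2) / K\<close>. For \<open>K < 2\<close> its first summand may be negative; it decreases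
      when \<open>t (K - 2)\<close> is replaced by \<open>(a + b) (K - 2)\<close> and then \<open>K\<close> by its lower bound \<open>1 + a\<close> in the
      inner factor, and what remains is \<open>(1 - a) (b - a) (K - t)\<close>.\<close>
    have "0 \<le> t * (t * (K - 2) + 2 * (K - 1) * (1 - a)) + K * (1 - a) * (b - a)"
    proof (cases "K \<ge> 2")
      case True
      then show ?thesis using ab t0 by simp
    next
      case False
      have "0 \<le> (K - (1 + a)) * (2 - a + b)" using K_lower ab by simp
      then have "(1 - a) * (a - b) \<le> (a + b) * (K - 2) + 2 * (K - 1) * (1 - a)"
        by (simp add: algebra_simps)
      also have "(a + b) * (K - 2) \<le> t * (K - 2)"
        using False t by (intro mult_right_mono_neg) auto
      finally have "t * ((1 - a) * (a - b)) \<le> t * (t * (K - 2) + 2 * (K - 1) * (1 - a))"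
        using t0 by (intro mult_left_mono) auto
      moreover have "0 \<le> (1 - a) * (b - a) * (K - t)" using ab \<open>K \<ge> t\<close> by simp
      ultimately show ?thesis by (simp add: algebra_simps)
    qed
    then have "0 \<le> K * (t * (t * (K - 2) + 2 * (K - 1) * (1 - a)) + K * (1 - a) * (b - a))"
      using K by simp
    also have "\<dots> = v\<^sup>2 - A\<^sup>2"
      unfolding A2 R2 g2 v_def by (simp add: power2_eq_square algebra_simps)
    finally have "A\<^sup>2 \<le> v\<^sup>2" by simp
    moreover have "v \<ge> 0" using t0 K_lower ab by (simp add: v_def)
    ultimately have "A \<le> v" by (rule power2_le_imp_le)
    then show ?thesis by (simp add: v_def algebra_simps)
  qed
  then have "(t + A) / (g * K) \<le> (t + (1 - a)) * K / (g * K)"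
    using g K by (intro divide_right_mono) auto
  then show "E \<le> Q"
    unfolding E Q_def R g_def[symmetric] using K by simp

  define m where "m = t + A"
  \<comment> \<open>Both estimates of \<open>E\<close> below rest on this bound, which comes from \<open>A \<ge> 1 - a b\<close>
    and \<open>t \<ge> b - a\<close>.\<close>
  have m: "(1 - a) * (1 + b) \<le> m"
  proof -
    have "(b - a)\<^sup>2 \<le> t\<^sup>2" using ab t by (intro power_mono) auto
    then have "(1 - a * b)\<^sup>2 \<le> A\<^sup>2"
      unfolding A2 R2 g2 K2 by (simp add: power2_eq_square algebra_simps)
    moreover have "A \<ge> 0" by (simp add: A_def)
    ultimately have "1 - a * b \<le> A" by (rule power2_le_imp_le)
    then show ?thesis using t by (simp add: m_def algebra_simps)
  qed
  have E1: "(1 - a) / g \<le> E"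
  proof -
    have "(1 - a) * K \<le> (1 - a) * (1 + b)" using K_upper ab by (intro mult_left_mono) auto
    then have "(1 - a) * K / (g * K) \<le> m / (g * K)"
      using m g K by (intro divide_right_mono) auto
    then show ?thesis unfolding E R m_def[symmetric] using K by simp
  qed
  \<comment> \<open>Since \<open>m\<^sup>2 = 2 t m + R\<^sup>2\<close>, the claim amounts to \<open>R\<^sup>2 \<le> 2 (1 - a) m\<close>.\<close>
  have E2: "1 + t / (1 - a) \<le> E\<^sup>2"
  proof -
    have "(1 + a) * (1 - b) \<le> 2 * (1 - a)" using ab by (intro mult_mono) auto
    then have "(1 + a) * (1 - b) * (1 + b) \<le> 2 * (1 - a) * (1 + b)"
      using ab by (intro mult_right_mono) auto
    also have "\<dots> \<le> 2 * m"
      using mult_left_mono[OF m, of 2] by (simp only: mult.assoc zero_le_numeral)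
    finally have "(1 - a) * ((1 + a) * (1 - b) * (1 + b)) \<le> (1 - a) * (2 * m)"
      using ab by (intro mult_left_mono) auto
    then have "R\<^sup>2 \<le> (1 - a) * (2 * m)" unfolding R2 g2 K2 by (simp add: mult_ac)
    then have "t * R\<^sup>2 \<le> t * ((1 - a) * (2 * m))" using t0 by (intro mult_left_mono)
    then have "t / (1 - a) \<le> 2 * t * m / R\<^sup>2" using ab R0 by (simp add: field_simps)
    moreover have "m\<^sup>2 = 2 * t * m + R\<^sup>2"
      using A2 by (simp add: m_def power2_eq_square algebra_simps)
    then have "E\<^sup>2 = 2 * t * m / R\<^sup>2 + 1"
      using R0 by (simp add: E m_def[symmetric] power_divide add_divide_distrib)
    ultimately show ?thesis by simp
  qed
  have "Q = (1 - a) / g * (1 + t / (1 - a))"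
    unfolding Q_def g_def[symmetric] using ab g by (simp add: field_simps)
  also have "\<dots> \<le> E * E\<^sup>2"
    using E1 E2 ab t0 g by (intro mult_mono) (auto simp: E_def)
  finally show "Q \<le> E ^ 3" by (simp add: power2_eq_square power3_eq_cube mult.assoc)
qed

lemma gromov_dist_commute: "gromov_dist D x y = gromov_dist D y x"
  by (simp add: gromov_dist_def Let_def norm_minus_commute max.commute mult.commute)

lemma hyp_dist_commute: "hyp_dist x y = hyp_dist y x"
  by (simp add: hyp_dist_def norm_minus_commute mult.commute)

lemma gromov_dist_hyp_dist:
  fixes x y :: "'a::euclidean_space"
  assumes "x \<in> ball 0 1" "y \<in> ball 0 1"
  shows "hyp_dist x y \<le> gromov_dist (ball 0 1) x y \<and> gromov_dist (ball 0 1) x y \<le> 3 * hyp_dist x y"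
  using assms
proof (induction "norm x" "norm y" arbitrary: x y rule: linorder_wlog)
  case le
  define s where "s = arsinh (norm (x - y) / sqrt ((1 - (norm x)\<^sup>2) * (1 - (norm y)\<^sup>2)))"
  define Q where "Q = (norm (x - y) + (1 - norm x)) / sqrt ((1 - norm x) * (1 - norm y))"
  have "norm y - norm x \<le> norm (x - y)" "norm (x - y) \<le> norm x + norm y"
    using norm_triangle_ineq2[of y x] norm_triangle_ineq4[of x y] by (simp_all add: norm_minus_commute)
  then have "exp s \<le> Q" "Q \<le> exp s ^ 3"
    using gromov_quotient_bounds[of "norm x" "norm y" "norm (x - y)"] le by (simp_all add: s_def Q_def)
  moreover have "Q > 0" using \<open>exp s \<le> Q\<close> exp_gt_zero[of s] by linarith
  moreover have "exp s ^ 3 = exp (3 * s)" using exp_of_nat_mult[of 3 s] by simp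
  ultimately have "s \<le> ln Q" "ln Q \<le> 3 * s"
    using ln_ge_iff[of Q s] ln_le_cancel_iff[of Q "exp (3 * s)"] by simp_all
  moreover have "gromov_dist (ball 0 1) x y = 2 * ln Q"
    using le by (simp add: gromov_dist_ball Q_def max_def)
  ultimately show ?case by (simp add: hyp_dist_def s_def)
next
  case sym
  then show ?case by (metis gromov_dist_commute hyp_dist_commute)
qed

section \<open>Sharpness of the constants\<close>

lemma ball_reflection_on_diameter:
  fixes e :: "'a::euclidean_space"
  assumes e: "norm e = 1" and \<tau>: "0 < \<tau>" "\<tau> < 1" and c: "\<bar>c\<bar> < 1"
  shows "ball_reflection (\<tau> *\<^sub>R e) (Some (c *\<^sub>R e)) = Some (((\<tau> - c) / (1 - \<tau> * c)) *\<^sub>R e)"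
proof -
  have "\<tau> * c \<le> \<tau> * 1" using \<tau> c by (intro mult_left_mono) auto
  then have tc: "\<tau> * c < 1" using \<tau> by linarith
  have center: "(\<tau> *\<^sub>R e) /\<^sub>R (norm (\<tau> *\<^sub>R e))\<^sup>2 = (1 / \<tau>) *\<^sub>R e"
    using e \<tau> by (simp add: power2_eq_square divide_simps)
  have "\<tau>\<^sup>2 < 1" using \<tau> by (simp add: power_less_one_iff)
  then have radius: "(sqrt (1 / (norm (\<tau> *\<^sub>R e))\<^sup>2 - 1))\<^sup>2 = 1 / \<tau>\<^sup>2 - 1"
    using e \<tau> by (simp add: field_simps)
  have ne: "c - 1 / \<tau> \<noteq> 0" using tc \<tau> by (auto simp: field_simps)
  have diff: "c *\<^sub>R e - (1 / \<tau>) *\<^sub>R e = (c - 1 / \<tau>) *\<^sub>R e" by (simp add: scaleR_diff_left)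
  have "1 / \<tau> + (1 / \<tau>\<^sup>2 - 1) / (c - 1 / \<tau>)\<^sup>2 * (c - 1 / \<tau>) = 1 / \<tau> + (1 / \<tau>\<^sup>2 - 1) / (c - 1 / \<tau>)"
    using ne by (simp add: power2_eq_square)
  also have "\<dots> = 1 / \<tau> + (1 / \<tau>\<^sup>2 - 1) / (- (1 - \<tau> * c) / \<tau>)"
    using \<tau> by (simp add: diff_divide_distrib)
  also have "\<dots> = (\<tau> - c) / (1 - \<tau> * c)"
    using \<tau> tc by (simp add: power2_eq_square divide_simps) (simp add: algebra_simps)
  finally have "(1 / \<tau>) *\<^sub>R e + ((1 / \<tau>\<^sup>2 - 1) / (c - 1 / \<tau>)\<^sup>2) *\<^sub>R (c *\<^sub>R e - (1 / \<tau>) *\<^sub>R e)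
      = ((\<tau> - c) / (1 - \<tau> * c)) *\<^sub>R e"
    by (simp only: diff scaleR_scaleR scaleR_add_left[symmetric])
  moreover have "c *\<^sub>R e \<noteq> (1 / \<tau>) *\<^sub>R e" using diff ne e by auto
  moreover have "(norm (c *\<^sub>R e - (1 / \<tau>) *\<^sub>R e))\<^sup>2 = (c - 1 / \<tau>)\<^sup>2" using e by (simp add: diff)
  ultimately show ?thesis
    by (simp only: ball_reflection_def sphere_reflection_def center radius option.case if_False)
qed

text \<open>The value of \<open>u\<close> at the pair \<open>s e, - s e\<close>, for a unit vector \<open>e\<close>.\<close>

definition symmetric_gap :: "real \<Rightarrow> real" where
  "symmetric_gap s = 2 * ln ((1 + s) / (1 - s))"

text \<open>The value of \<open>u\<close> at the images \<open>\<alpha> e\<close> and \<open>\<beta> e\<close> of \<open>s e\<close> and \<open>- s e\<close> under the reflection exchanging \<open>0\<close>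
  and \<open>(1 - s) e\<close>.\<close>

definition displaced_gap :: "real \<Rightarrow> real" where
  "displaced_gap s = (let \<alpha> = (1 - 2 * s) / (1 - s + s\<^sup>2); \<beta> = 1 / (1 + s - s\<^sup>2)
    in 2 * ln ((\<beta> - \<alpha> + (1 - \<alpha>)) / sqrt ((1 - \<alpha>) * (1 - \<beta>))))"

text \<open>The bound \<open>1/2\<close> on \<open>s\<close> keeps \<open>\<alpha>\<close> positive, so that both image points lie on the same radius.\<close>

lemma extremal_pairs:
  fixes s :: real
  assumes s: "0 < s" "s < 1 / 2"
  shows "\<exists>f \<in> moebius_self_maps (ball (0::'a::euclidean_space) 1). \<exists>x \<in> ball 0 1. \<exists>y \<in> ball 0 1.
    (\<forall>z. f (f z) = z) \<and>
    gromov_dist (ball 0 1) x y = symmetric_gap s \<and>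
    gromov_dist (ball 0 1) (fin_app f x) (fin_app f y) = displaced_gap s"
proof -
  define \<alpha> where "\<alpha> = (1 - 2 * s) / (1 - s + s\<^sup>2)"
  define \<beta> where "\<beta> = 1 / (1 + s - s\<^sup>2)"
  obtain e :: 'a where e: "norm e = 1" using norm_Basis nonempty_Basis by blast
  define p where "p = (1 - s) *\<^sub>R e"
  define f where "f = ball_reflection p"
  have p: "p \<in> ball 0 1" "p \<noteq> 0" using e s by (auto simp: p_def)
  have x: "s *\<^sub>R e \<in> ball 0 1" and y: "(- s) *\<^sub>R e \<in> ball 0 1" using e s by auto
  have fx: "f (Some (s *\<^sub>R e)) = Some (\<alpha> *\<^sub>R e)"
    using ball_reflection_on_diameter[OF e, of "1 - s" s] s
    by (simp add: f_def p_def \<alpha>_def power2_eq_square algebra_simps)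
  have fy: "f (Some ((- s) *\<^sub>R e)) = Some (\<beta> *\<^sub>R e)"
    using ball_reflection_on_diameter[OF e, of "1 - s" "- s"] s
    by (simp add: f_def p_def \<beta>_def power2_eq_square algebra_simps)
  have s2: "0 < s\<^sup>2" "s\<^sup>2 < s" using s by (auto simp: power2_eq_square)
  have \<alpha>: "0 < \<alpha>" "\<alpha> \<le> \<beta>" and \<beta>: "\<beta> < 1"
  proof -
    show "0 < \<alpha>" unfolding \<alpha>_def using s s2 by (intro divide_pos_pos) linarith+
    show "\<beta> < 1" using s s2 by (simp add: \<beta>_def)
    have "(1 - 2 * s) * (1 + s - s\<^sup>2) \<le> 1 - s + s\<^sup>2"
    proof -
      have "1 - s + s\<^sup>2 - (1 - 2 * s) * (1 + s - s\<^sup>2) = 2 * s\<^sup>2 * (2 - s)"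
        by (simp add: power2_eq_square algebra_simps)
      moreover have "0 \<le> 2 * s\<^sup>2 * (2 - s)" using s by simp
      ultimately show ?thesis by linarith
    qed
    moreover have "0 < 1 - s + s\<^sup>2" "0 < 1 + s - s\<^sup>2" using s s2 by linarith+
    ultimately show "\<alpha> \<le> \<beta>"
      unfolding \<alpha>_def \<beta>_def
      by (simp only: pos_divide_le_eq pos_le_divide_eq times_divide_eq_left mult_1_left)
  qed
  have fxy: "\<alpha> *\<^sub>R e \<in> ball 0 1" "\<beta> *\<^sub>R e \<in> ball 0 1" using \<alpha> \<beta> e by auto
  have "gromov_dist (ball 0 1) (s *\<^sub>R e) ((- s) *\<^sub>R e) = symmetric_gap s"
    unfolding symmetric_gap_def gromov_dist_ball[OF x y] using e s
    by (simp flip: scaleR_2)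
  moreover have "gromov_dist (ball 0 1) (\<alpha> *\<^sub>R e) (\<beta> *\<^sub>R e) = displaced_gap s"
    unfolding gromov_dist_ball[OF fxy] displaced_gap_def Let_def \<alpha>_def[symmetric] \<beta>_def[symmetric] using e \<alpha> \<beta>
    by (simp flip: scaleR_diff_left)
  moreover have "f (f z) = z" for z unfolding f_def by (rule ball_reflection_involution[OF p])
  moreover have "f \<in> moebius_self_maps (ball 0 1)" unfolding f_def by (rule ball_reflection_self_map[OF p])
  ultimately show ?thesis using x y fx fy by (metis option.sel)
qed

text \<open>Up to terms of higher order in \<open>s\<close>, \<open>1 - \<alpha>\<close> and \<open>1 - \<beta>\<close> are \<open>s (1 + 2 s)\<close> and \<open>s (1 - 2 s)\<close>, and \<open>\<beta> - \<alpha>\<close> is \<open>4 s\<^sup>2\<close>.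
  The displaced quotient is therefore \<open>1 + 6 s\<close>, against \<open>1 + 2 s\<close> for the symmetric pair.\<close>

lemma gap_ratio_limit: "((\<lambda>s. displaced_gap s / symmetric_gap s) \<longlongrightarrow> 3) (at_right 0)"
  unfolding displaced_gap_def symmetric_gap_def Let_def by real_asymp

lemma moebius_gromov_dist_bounds:
  fixes f :: "'a::euclidean_space option \<Rightarrow> 'a option"
  assumes f: "f \<in> moebius_self_maps (ball 0 1)" and x: "x \<in> ball 0 1" and y: "y \<in> ball 0 1"
  shows "1 / 3 * gromov_dist (ball 0 1) x y \<le> gromov_dist (ball 0 1) (fin_app f x) (fin_app f y)"
    and "gromov_dist (ball 0 1) (fin_app f x) (fin_app f y) \<le> 3 * gromov_dist (ball 0 1) x y"
proof -
  have "fin_app f x \<in> ball 0 1" "fin_app f y \<in> ball 0 1"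
    using moebius_self_maps_Some[OF f x] moebius_self_maps_Some[OF f y] by (metis option.sel)+
  then show "1 / 3 * gromov_dist (ball 0 1) x y \<le> gromov_dist (ball 0 1) (fin_app f x) (fin_app f y)"
    and "gromov_dist (ball 0 1) (fin_app f x) (fin_app f y) \<le> 3 * gromov_dist (ball 0 1) x y"
    using gromov_dist_hyp_dist[OF x y] gromov_dist_hyp_dist[of "fin_app f x" "fin_app f y"]
      hyp_dist_moebius[OF f x y] by linarith+
qed

lemma moebius_gromov_dist_upper_sharp:
  fixes C :: real
  assumes C: "\<And>f x y. \<lbrakk>f \<in> moebius_self_maps (ball (0::'a::euclidean_space) 1); x \<in> ball 0 1; y \<in> ball 0 1\<rbrakk>
    \<Longrightarrow> gromov_dist (ball 0 1) (fin_app f x) (fin_app f y) \<le> C * gromov_dist (ball 0 1) x y"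
  shows "3 \<le> C"
proof (rule tendsto_upperbound[OF gap_ratio_limit])
  have "\<forall>\<^sub>F s :: real in at_right 0. s \<in> {0<..<1 / 2}"
    by (rule eventually_at_right_real) simp
  then show "\<forall>\<^sub>F s in at_right 0. displaced_gap s / symmetric_gap s \<le> C"
  proof (rule eventually_mono)
    fix s :: real assume "s \<in> {0<..<1 / 2}"
    then have s: "0 < s" "s < 1 / 2" by auto
    then have "symmetric_gap s > 0" by (simp add: symmetric_gap_def)
    moreover have "displaced_gap s \<le> C * symmetric_gap s"
      using extremal_pairs[OF s, where 'a='a] C by metis
    ultimately show "displaced_gap s / symmetric_gap s \<le> C" by (simp add: field_simps)
  qed
qed simp

text \<open>The extremal reflection is applied to the displaced pair, which it carries back to the symmetric one.\<close>

lemma moebius_gromov_dist_lower_sharp: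
  fixes c :: real
  assumes c: "\<And>f x y. \<lbrakk>f \<in> moebius_self_maps (ball (0::'a::euclidean_space) 1); x \<in> ball 0 1; y \<in> ball 0 1\<rbrakk>
    \<Longrightarrow> c * gromov_dist (ball 0 1) x y \<le> gromov_dist (ball 0 1) (fin_app f x) (fin_app f y)"
  shows "c \<le> 1 / 3"
proof -
  have "c * 3 \<le> 1"
  proof (rule tendsto_upperbound[OF tendsto_mult_left[OF gap_ratio_limit]])
    have "\<forall>\<^sub>F s :: real in at_right 0. s \<in> {0<..<1 / 2}"
      by (rule eventually_at_right_real) simp
    then show "\<forall>\<^sub>F s in at_right 0. c * (displaced_gap s / symmetric_gap s) \<le> 1"
    proof (rule eventually_mono)
      fix s :: real assume "s \<in> {0<..<1 / 2}"
      then have s: "0 < s" "s < 1 / 2" by auto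
      then have pos: "symmetric_gap s > 0" by (simp add: symmetric_gap_def)
      obtain f and x y :: 'a where f: "f \<in> moebius_self_maps (ball 0 1)" "\<And>z. f (f z) = z"
        and xy: "x \<in> ball 0 1" "y \<in> ball 0 1"
        and gap: "gromov_dist (ball 0 1) x y = symmetric_gap s"
          "gromov_dist (ball 0 1) (fin_app f x) (fin_app f y) = displaced_gap s"
        using extremal_pairs[OF s, where 'a='a] by metis
      obtain x' where x': "x' \<in> ball 0 1" "f (Some x) = Some x'" using moebius_self_maps_Some[OF f(1) xy(1)] .
      obtain y' where y': "y' \<in> ball 0 1" "f (Some y) = Some y'" using moebius_self_maps_Some[OF f(1) xy(2)] .
      have "c * displaced_gap s \<le> symmetric_gap s"
        using c[OF f(1) x'(1) y'(1)] gap f(2)[of "Some x"] f(2)[of "Some y"] by (simp add: x' y')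
      with pos show "c * (displaced_gap s / symmetric_gap s) \<le> 1" by (simp add: field_simps)
    qed
  qed simp
  then show ?thesis by simp
qed

theorem theorem6p3:
  fixes B :: "(real ^ 'n) set"
  defines "B \<equiv> ball 0 1"
  shows
    "(\<forall>f \<in> moebius_self_maps B. \<forall>x \<in> B. \<forall>y \<in> B.
        1 / 3 * gromov_dist B x y \<le> gromov_dist B (fin_app f x) (fin_app f y) \<and>
        gromov_dist B (fin_app f x) (fin_app f y) \<le> 3 * gromov_dist B x y)
     \<and> (\<forall>c::real. (\<forall>f \<in> moebius_self_maps B. \<forall>x \<in> B. \<forall>y \<in> B.
          c * gromov_dist B x y \<le> gromov_dist B (fin_app f x) (fin_app f y)) \<longrightarrow> c \<le> 1 / 3)
     \<and> (\<forall>C::real. (\<forall>f \<in> moebius_self_maps B. \<forall>x \<in> B. \<forall>y \<in> B.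
          gromov_dist B (fin_app f x) (fin_app f y) \<le> C * gromov_dist B x y) \<longrightarrow> 3 \<le> C)"
  unfolding B_def
proof (intro conjI ballI allI impI)
  fix f :: "(real ^ 'n) option \<Rightarrow> (real ^ 'n) option" and x y :: "real ^ 'n"
  assume "f \<in> moebius_self_maps (ball 0 1)" "x \<in> ball 0 1" "y \<in> ball 0 1"
  note bounds = moebius_gromov_dist_bounds[OF this]
  show "1 / 3 * gromov_dist (ball 0 1) x y \<le> gromov_dist (ball 0 1) (fin_app f x) (fin_app f y)"
    by (rule bounds)
  show "gromov_dist (ball 0 1) (fin_app f x) (fin_app f y) \<le> 3 * gromov_dist (ball 0 1) x y"
    by (rule bounds)
next
  fix c :: real
  assume "\<forall>f \<in> moebius_self_maps (ball (0 :: real ^ 'n) 1). \<forall>x \<in> ball 0 1. \<forall>y \<in> ball 0 1.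
    c * gromov_dist (ball 0 1) x y \<le> gromov_dist (ball 0 1) (fin_app f x) (fin_app f y)"
  then show "c \<le> 1 / 3" by (intro moebius_gromov_dist_lower_sharp[where 'a="real ^ 'n"]) blast
next
  fix C :: real
  assume "\<forall>f \<in> moebius_self_maps (ball (0 :: real ^ 'n) 1). \<forall>x \<in> ball 0 1. \<forall>y \<in> ball 0 1.
    gromov_dist (ball 0 1) (fin_app f x) (fin_app f y) \<le> C * gromov_dist (ball 0 1) x y"
  then show "3 \<le> C" by (intro moebius_gromov_dist_upper_sharp[where 'a="real ^ 'n"]) blast
qed

end
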